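(* For $z\in\mathbb{C}$ with $|z|<1$, $$E^2(z)=\frac{\pi^2}{4}F^2\left(-\tfrac12,\tfrac12;1;z^2\right)=\frac{\pi^2}{4}\sum_{n=0}^\infty u_n z^{2n},$$ where $u_0=1$, $u_1=-1/2$ and $$u_{n+1}=\frac{4n^3-2n-1}{2(n+1)^3}u_n-\frac{(n-2)(n-1)n}{(n+1)^3}u_{n-1},\qquad n\ge 1.$$
   Context: $E(z)=\int_0^{\pi/2}\sqrt{1-z^2\sin^2\theta}\,d\theta$, $|z|<1$ (principal square root), is the complete elliptic integral of the second kind, and $E^2(z)=(E(z))^2$. $F(a,b;c;z)=\sum_{k=0}^\infty \frac{(a)_k(b)_k}{(c)_k\,k!}z^k$, $|z|<1$, is the Gaussian hypergeometric function, with $(x)_k=x(x+1)\cdots(x+k-1)$, $(x)_0=1$; $F^2$ denotes its square. *)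

theory Defs
  imports "HOL-Analysis.Analysis"
begin

text \<open>
  Complete elliptic integral of the second kind, as a function of the complex modulus \<open>z\<close>
  (not of the parameter \<open>m = z\<^sup>2\<close>); meant for \<open>norm z < 1\<close>. The constant \<open>csqrt\<close> is the
  principal square root.
\<close>
definition elliptic_E :: "complex \<Rightarrow> complex" where
  "elliptic_E z = integral {0..pi/2} (\<lambda>\<theta>. csqrt (1 - z^2 * (of_real (sin \<theta>))^2))"

text \<open>Gaussian hypergeometric function, given by its series; meant for \<open>norm z < 1\<close>.\<close>
definition hypergeo_2F1 :: "complex \<Rightarrow> complex \<Rightarrow> complex \<Rightarrow> complex \<Rightarrow> complex" where
  "hypergeo_2F1 a b c z =
     (\<Sum>k. pochhammer a k * pochhammer b k / (pochhammer c k * fact k) * z^k)"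

end

theory Submission
  imports Defs "HOL-Computational_Algebra.Formal_Power_Series"
begin

text \<open>
  The first equation is a termwise integration. Expanding the integrand by the binomial series in
  \<open>z\<^sup>2 sin\<^sup>2 \<theta>\<close> gives a series that converges uniformly in \<open>\<theta>\<close>, because
  \<open>\<bar>(-1/2)\<^sub>k\<bar> \<le> k!\<close>; the Wallis integrals \<open>wallis_integral\<close> supply the factor
  \<open>(\<pi>/2) (1/2)\<^sub>k / k!\<close> that turns the binomial coefficients into hypergeometric ones
  (\<open>elliptic_E_eq_hypergeo\<close>).

  For the recurrence, write \<open>\<delta> = X d/dX\<close>. The series \<open>f = F(-1/2, 1/2; 1; X)\<close> satisfies
  \<open>4 (1 - X) \<delta>\<^sup>2 f + X f = 0\<close>. The square of a solution of a linear second-order equation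
  satisfies a linear third-order equation, the symmetric square; here it is
  \<open>2 (1 - X)\<^sup>2 \<delta>\<^sup>3 w + 2 X (1 - X) \<delta> w + X w = 0\<close> for \<open>w = f\<^sup>2\<close>
  (\<open>symmetric_square_ode\<close>). Since \<open>\<delta>\<close> multiplies the \<open>n\<close>-th coefficient by \<open>n\<close> and the polynomial
  coefficients have degree two, comparing coefficients gives a three-term recurrence, which is the
  one for \<open>u\<close>. It determines \<open>u\<close> from \<open>u\<^sub>0\<close> and \<open>u\<^sub>1\<close>, so the \<open>u\<^sub>n\<close> are the coefficients
  of \<open>f\<^sup>2\<close>, and the Cauchy product carries this from formal power series to convergent ones.
\<close>

section \<open>The recurrence for the squared hypergeometric series\<close>

text \<open>
  The differential equations are written with the Euler operator because it is diagonal on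
  coefficients, so that they translate directly into recurrences.
\<close>
definition fps_euler :: "'a::comm_ring_1 fps \<Rightarrow> 'a fps" where
  "fps_euler f = fps_X * fps_deriv f"

lemma fps_euler_nth [simp]: "fps_nth (fps_euler f) n = of_nat n * fps_nth f n"
  by (cases n) (simp_all add: fps_euler_def)

lemma fps_euler_mult: "fps_euler (f * g) = fps_euler f * g + f * fps_euler g"
  by (simp add: fps_euler_def algebra_simps)

lemma fps_euler_add: "fps_euler (f + g) = fps_euler f + fps_euler g"
  by (simp add: fps_euler_def algebra_simps)

lemma fps_euler_diff: "fps_euler (f - g) = fps_euler f - fps_euler g"
  by (simp add: fps_euler_def algebra_simps)

lemma fps_euler_numeral [simp]: "fps_euler (numeral k) = 0"
  by (simp add: fps_euler_def)

lemma fps_euler_1 [simp]: "fps_euler 1 = 0"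
  by (simp add: fps_euler_def)

lemma fps_euler_X [simp]: "fps_euler fps_X = fps_X"
  by (simp add: fps_euler_def)

text \<open>
  With \<open>L = 4 (1 - X) \<delta>\<^sup>2 f + X f\<close>, the left-hand side of the third-order equation is a combination of
  \<open>L\<close> and \<open>\<delta> L\<close>. The multiplier \<open>(1 - X) f\<close> of \<open>\<delta> L\<close> is forced by the term in \<open>f \<delta>\<^sup>3 f\<close>, the
  summand \<open>3 (1 - X) \<delta> f\<close> of the other one by the term in \<open>\<delta> f \<delta>\<^sup>2 f\<close>, and what remains is
  \<open>X f L\<close>.
\<close>
lemma symmetric_square_ode:
  fixes f :: "'a::comm_ring_1 fps"
  assumes ode: "4 * (1 - fps_X) * fps_euler (fps_euler f) + fps_X * f = 0"
  shows "2 * (1 - fps_X)\<^sup>2 * fps_euler (fps_euler (fps_euler (f\<^sup>2)))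
         + 2 * fps_X * (1 - fps_X) * fps_euler (f\<^sup>2) + fps_X * f\<^sup>2 = 0"
proof -
  define f1 f2 f3 where "f1 = fps_euler f" and "f2 = fps_euler f1" and "f3 = fps_euler f2"
  define L where "L = 4 * (1 - fps_X) * f2 + fps_X * f"
  have L: "L = 0"
    using ode by (simp add: L_def f1_def f2_def)
  have L': "fps_euler L = 4 * (1 - fps_X) * f3 - 4 * fps_X * f2 + fps_X * f + fps_X * f1"
    by (simp add: L_def f1_def f2_def f3_def fps_euler_mult fps_euler_add fps_euler_diff
        algebra_simps)
  have sq1: "fps_euler (f\<^sup>2) = 2 * f * f1"
    by (simp add: power2_eq_square fps_euler_mult f1_def)
  have sq3: "fps_euler (fps_euler (fps_euler (f\<^sup>2))) = 2 * f * f3 + 6 * f1 * f2"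
    by (simp add: sq1 fps_euler_mult fps_euler_add flip: f1_def f2_def f3_def)
  have "2 * (1 - fps_X)\<^sup>2 * fps_euler (fps_euler (fps_euler (f\<^sup>2)))
         + 2 * fps_X * (1 - fps_X) * fps_euler (f\<^sup>2) + fps_X * f\<^sup>2
        = (1 - fps_X) * f * fps_euler L + (3 * (1 - fps_X) * f1 + fps_X * f) * L"
    unfolding sq3 unfolding sq1 L' unfolding L_def by (simp add: algebra_simps power2_eq_square)
  thus ?thesis
    by (simp add: L fps_euler_def)
qed

text \<open>
  The coefficients of \<open>F(-1/2, 1/2; 1; X)\<close>, one of the two factorials being \<open>(1)\<^sub>k\<close>. They are taken
  as real numbers so that the recurrence can be compared with that of a real sequence.
\<close>
definition E_coeff :: "nat \<Rightarrow> real" where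
  "E_coeff k = pochhammer (-1/2) k * pochhammer (1/2) k / (fact k)\<^sup>2"

lemma E_coeff_0: "E_coeff 0 = 1"
  by (simp add: E_coeff_def)

lemma E_coeff_Suc: "4 * (real k + 1)\<^sup>2 * E_coeff (Suc k) = (4 * (real k)\<^sup>2 - 1) * E_coeff k"
proof -
  have "E_coeff (Suc k) = (real k - 1/2) * (real k + 1/2) / (real k + 1)\<^sup>2 * E_coeff k"
    by (simp add: E_coeff_def pochhammer_Suc power_mult_distrib add_ac)
  moreover have "4 * d * (p / d * c) = 4 * p * c" if "d \<noteq> 0" for c d p :: real
    using that by simp
  ultimately have "4 * (real k + 1)\<^sup>2 * E_coeff (Suc k)
      = 4 * ((real k - 1/2) * (real k + 1/2)) * E_coeff k"
    by simp
  thus ?thesis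
    by (simp add: algebra_simps power2_eq_square)
qed

lemma E_fps_ode:
  "4 * (1 - fps_X) * fps_euler (fps_euler (Abs_fps E_coeff)) + fps_X * Abs_fps E_coeff = 0"
proof (rule fps_ext)
  fix n
  show "fps_nth (4 * (1 - fps_X) * fps_euler (fps_euler (Abs_fps E_coeff))
         + fps_X * Abs_fps E_coeff) n = fps_nth 0 n"
    using E_coeff_Suc[of "n - 1"]
    by (cases n) (simp_all add: numeral_fps_const left_diff_distrib right_diff_distrib mult.assoc
          power2_eq_square algebra_simps)
qed

text \<open>
  The coefficient of \<open>X\<^sup>n\<^sup>+\<^sup>1\<close> in the symmetric square equation.
\<close>
lemma E_fps_sq_rec:
  fixes n :: nat
  assumes "n \<ge> 1"
  defines "w \<equiv> fps_nth ((Abs_fps E_coeff)\<^sup>2)"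
  shows "w (n + 1) = (4 * real n ^ 3 - 2 * real n - 1) / (2 * (real n + 1) ^ 3) * w n
           - (real n - 2) * (real n - 1) * real n / (real n + 1) ^ 3 * w (n - 1)"
proof -
  obtain m where n: "n = Suc m"
    using assms(1) by (cases n) auto
  define W where "W = (Abs_fps E_coeff)\<^sup>2"
  \<comment> \<open>Multiplications by constants and by single powers of \<open>X\<close> have simple coefficients, so the
    polynomial factors are expanded into these.\<close>
  have "2 * (1 - fps_X)\<^sup>2 * fps_euler (fps_euler (fps_euler W))
         + 2 * fps_X * (1 - fps_X) * fps_euler W + fps_X * W
       = fps_const 2 * fps_euler (fps_euler (fps_euler W))
         - fps_const 4 * (fps_X * fps_euler (fps_euler (fps_euler W)))
         + fps_const 2 * (fps_X * (fps_X * fps_euler (fps_euler (fps_euler W))))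
         + fps_const 2 * (fps_X * fps_euler W)
         - fps_const 2 * (fps_X * (fps_X * fps_euler W)) + fps_X * W"
    by (simp add: power2_eq_square algebra_simps flip: numeral_fps_const)
  also have "2 * (1 - fps_X)\<^sup>2 * fps_euler (fps_euler (fps_euler W))
         + 2 * fps_X * (1 - fps_X) * fps_euler W + fps_X * W = 0"
    unfolding W_def by (rule symmetric_square_ode[OF E_fps_ode])
  finally have "fps_nth 0 (Suc (Suc m)) = fps_nth (fps_const 2 * fps_euler (fps_euler (fps_euler W))
         - fps_const 4 * (fps_X * fps_euler (fps_euler (fps_euler W)))
         + fps_const 2 * (fps_X * (fps_X * fps_euler (fps_euler (fps_euler W))))
         + fps_const 2 * (fps_X * fps_euler W)
         - fps_const 2 * (fps_X * (fps_X * fps_euler W)) + fps_X * W) (Suc (Suc m))"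
    by (rule arg_cong)
  hence "2 * (real n + 1) ^ 3 * w (n + 1) = (4 * real n ^ 3 - 2 * real n - 1) * w n
           - 2 * ((real n - 2) * (real n - 1) * real n) * w (n - 1)"
    by (simp add: n w_def flip: W_def) (simp add: algebra_simps power3_eq_cube)
  moreover have "c = a / (2 * d) * x - b / d * y"
    if "2 * d * c = a * x - 2 * b * y" "d \<noteq> 0" for a b c d x y :: real
    using that by (simp add: field_simps)
  ultimately show ?thesis
    by simp
qed

lemma E_fps_sq_unique:
  fixes u :: "nat \<Rightarrow> real"
  assumes "u 0 = 1" and "u 1 = - 1 / 2"
    and "\<And>n::nat. n \<ge> 1 \<Longrightarrow>
           u (n + 1) = (4 * real n ^ 3 - 2 * real n - 1) / (2 * (real n + 1) ^ 3) * u n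
                       - (real n - 2) * (real n - 1) * real n / (real n + 1) ^ 3 * u (n - 1)"
  shows "u n = fps_nth ((Abs_fps E_coeff)\<^sup>2) n"
proof (induction n rule: less_induct)
  case (less n)
  consider "n = 0" | "n = 1" | m where "n = m + 1" "m \<ge> 1"
    by (metis Suc_eq_plus1 not_less_eq_eq One_nat_def le0 not0_implies_Suc)
  thus ?case
  proof cases
    case 1
    thus ?thesis by (simp add: assms(1) power2_eq_square E_coeff_0)
  next
    case 2
    thus ?thesis
      by (simp add: assms(2)[simplified] power2_eq_square fps_mult_nth E_coeff_def)
  next
    case 3
    thus ?thesis
      using less.IH[of m] less.IH[of "m - 1"] by (simp only: assms(3) E_fps_sq_rec)
  qed
qed

section \<open>Convergence and the Cauchy product\<close>

text \<open>
  Factor by factor, \<open>\<bar>a + i\<bar> \<le> 1 + i\<close>. This crude bound suffices below: it makes both the hypergeometric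
  and the binomial coefficients bounded by \<open>1\<close>, so that geometric series dominate.
\<close>
lemma abs_pochhammer_le_fact:
  fixes a :: real
  assumes "\<bar>a\<bar> \<le> 1"
  shows "\<bar>pochhammer a k\<bar> \<le> fact k"
proof (induction k)
  case (Suc k)
  have "\<bar>a + real k\<bar> \<le> real (Suc k)"
    using assms by simp
  from mult_mono[OF Suc this] show ?case
    by (simp add: pochhammer_Suc abs_mult mult.commute)
qed simp

lemma abs_E_coeff_le_1: "\<bar>E_coeff k\<bar> \<le> 1"
  using mult_mono[OF abs_pochhammer_le_fact[of "-1/2" k] abs_pochhammer_le_fact[of "1/2" k]]
  by (simp add: E_coeff_def abs_mult power2_eq_square)

lemma summable_norm_E_series:
  fixes m :: complex
  assumes "norm m < 1"
  shows "summable (\<lambda>k. norm (of_real (E_coeff k) * m ^ k))"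
proof (rule summable_comparison_test')
  show "summable (\<lambda>k. norm m ^ k)"
    using assms by (simp add: summable_geometric)
  show "norm (norm (of_real (E_coeff k) * m ^ k)) \<le> norm m ^ k" for k
    using mult_right_mono[OF abs_E_coeff_le_1[of k], of "norm m ^ k"]
    by (simp add: norm_mult norm_power)
qed

lemma hypergeo_eq_E_series:
  "hypergeo_2F1 (- 1 / 2) (1 / 2) 1 m = (\<Sum>k. of_real (E_coeff k) * m ^ k)"
proof -
  have "pochhammer (- 1 / 2) k = complex_of_real (pochhammer (- 1 / 2) k)"
       "pochhammer (1 / 2) k = complex_of_real (pochhammer (1 / 2) k)" for k
    by (simp_all flip: pochhammer_of_real)
  thus ?thesis
    by (simp add: hypergeo_2F1_def E_coeff_def power2_eq_square flip: pochhammer_fact)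
qed

lemma hypergeo_square_sums:
  fixes m :: complex
  assumes "norm m < 1"
  shows "(\<lambda>n. of_real (fps_nth ((Abs_fps E_coeff)\<^sup>2) n) * m ^ n) sums
           (hypergeo_2F1 (- 1 / 2) (1 / 2) 1 m)\<^sup>2"
proof -
  have "(\<Sum>i\<le>n. of_real (E_coeff i) * m ^ i * (of_real (E_coeff (n - i)) * m ^ (n - i)))
        = of_real (fps_nth ((Abs_fps E_coeff)\<^sup>2) n) * m ^ n" for n
  proof -
    have "of_real (E_coeff i) * m ^ i * (of_real (E_coeff (n - i)) * m ^ (n - i))
          = of_real (E_coeff i * E_coeff (n - i)) * m ^ n" if "i \<le> n" for i
      using power_add[of m i "n - i"] that by simp
    hence "(\<Sum>i\<le>n. of_real (E_coeff i) * m ^ i * (of_real (E_coeff (n - i)) * m ^ (n - i)))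
          = (\<Sum>i\<le>n. of_real (E_coeff i * E_coeff (n - i)) * m ^ n)"
      by (intro sum.cong) auto
    thus ?thesis
      by (simp add: power2_eq_square fps_mult_nth atLeast0AtMost sum_distrib_right)
  qed
  with Cauchy_product_sums[OF summable_norm_E_series[OF assms] summable_norm_E_series[OF assms]]
  show ?thesis
    by (simp only: hypergeo_eq_E_series power2_eq_square)
qed

section \<open>The elliptic integral as a hypergeometric series\<close>

text \<open>
  Integrating the derivative of \<open>sin\<^sup>2\<^sup>k\<^sup>+\<^sup>1 \<theta> cos \<theta>\<close>, which vanishes at both ends of the interval,
  relates the integrals for \<open>k\<close> and \<open>k + 1\<close>.
\<close>
lemma wallis_integral:
  "((\<lambda>\<theta>. sin \<theta> ^ (2 * k)) has_integral (pi / 2 * (pochhammer (1/2) k / fact k))) {0..pi/2}"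
proof (induction k)
  case 0
  show ?case
    using has_integral_const_real[of "1::real" 0 "pi/2"] by simp
next
  case (Suc k)
  let ?d = "\<lambda>\<theta>::real. (2 * real k + 1) * sin \<theta> ^ (2 * k) - (2 * real k + 2) * sin \<theta> ^ (2 * Suc k)"
  have "(?d has_integral (sin (pi/2) ^ (2 * k + 1) * cos (pi/2) - sin 0 ^ (2 * k + 1) * cos 0)) {0..pi/2}"
  proof (rule fundamental_theorem_of_calculus)
    fix x :: real
    have "((\<lambda>\<theta>. sin \<theta> ^ (2 * k + 1) * cos \<theta>) has_real_derivative
            (2 * real k + 1) * sin x ^ (2 * k) * (cos x)\<^sup>2 - sin x ^ (2 * Suc k)) (at x within {0..pi/2})"
      by (rule derivative_eq_intros refl)+ (simp add: power2_eq_square algebra_simps)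
    also have "(2 * real k + 1) * sin x ^ (2 * k) * (cos x)\<^sup>2 - sin x ^ (2 * Suc k) = ?d x"
      unfolding cos_squared_eq by (simp add: algebra_simps power2_eq_square)
    finally show "((\<lambda>\<theta>. sin \<theta> ^ (2 * k + 1) * cos \<theta>) has_vector_derivative ?d x) (at x within {0..pi/2})"
      by (simp add: has_real_derivative_iff_has_vector_derivative)
  qed simp
  hence "(?d has_integral 0) {0..pi/2}"
    by simp
  from has_integral_diff[OF has_integral_mult_right[OF Suc.IH, of "2 * real k + 1"] this]
  have "((\<lambda>\<theta>. (2 * real k + 2) * sin \<theta> ^ (2 * Suc k)) has_integral
          ((2 * real k + 1) * (pi / 2 * (pochhammer (1/2) k / fact k)))) {0..pi/2}"
    by simp
  from has_integral_mult_right[OF this, of "1 / (2 * real k + 2)"]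
  have "((\<lambda>\<theta>. sin \<theta> ^ (2 * Suc k)) has_integral
          (1 / (2 * real k + 2) * ((2 * real k + 1) * (pi / 2 * (pochhammer (1/2) k / fact k))))) {0..pi/2}"
    by (simp del: power_Suc mult_Suc_right add: add_eq_0_iff)
  also have "1 / (2 * real k + 2) * ((2 * real k + 1) * (pi / 2 * (pochhammer (1/2) k / fact k)))
             = pi / 2 * (pochhammer (1/2) (Suc k) / fact (Suc k))"
    by (simp add: pochhammer_Suc field_simps)
  finally show ?case .
qed

text \<open>
  The principal square root is the principal power with exponent \<open>1/2\<close>, so the binomial series applies
  on the whole unit disc.
\<close>
lemma csqrt_one_minus_sums:
  fixes w :: complex
  assumes "norm w < 1"
  shows "(\<lambda>k. of_real (pochhammer (-1/2) k / fact k) * w ^ k) sums csqrt (1 - w)"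
proof -
  have "(\<lambda>k. ((1/2) gchoose k) * (- w) ^ k) sums (1 + (- w)) powr (1/2)"
    by (rule gen_binomial_complex) (use assms in simp)
  moreover have "((1/2) gchoose k) * (- w) ^ k = of_real (pochhammer (-1/2) k / fact k) * w ^ k" for k
  proof -
    have "pochhammer (- (1 / 2)) k = complex_of_real (pochhammer (- 1 / 2) k)"
      by (simp flip: pochhammer_of_real)
    moreover have "(- 1) ^ k * (- w) ^ k = w ^ k"
      by (simp flip: power_mult_distrib)
    ultimately show ?thesis
      by (simp add: gbinomial_pochhammer)
  qed
  ultimately show ?thesis
    by (simp add: csqrt_conv_powr)
qed

text \<open>
  The binomial series of the integrand is dominated by the geometric series in \<open>\<bar>z\<^sup>2\<bar>\<close>, uniformly in
  the angle, and may therefore be integrated term by term.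
\<close>
lemma elliptic_E_eq_hypergeo:
  assumes "norm z < 1"
  shows "elliptic_E z = of_real (pi / 2) * hypergeo_2F1 (- 1 / 2) (1 / 2) 1 (z\<^sup>2)"
proof -
  define g where "g k \<theta> = of_real (pochhammer (-1/2) k / fact k) *
      (z\<^sup>2 * (of_real (sin \<theta>))\<^sup>2) ^ k" for k and \<theta> :: real
  have z2: "norm (z\<^sup>2) < 1"
    using assms by (simp add: norm_power power_less_one_iff abs_square_less_1)
  have arg_le: "norm (z\<^sup>2 * (complex_of_real (sin \<theta>))\<^sup>2) \<le> norm (z\<^sup>2)" for \<theta>
    by (simp add: norm_mult norm_power mult_left_le abs_square_le_1)
  have g_suminf: "(\<Sum>k. g k \<theta>) = csqrt (1 - z\<^sup>2 * (of_real (sin \<theta>))\<^sup>2)" for \<theta>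
    unfolding g_def using le_less_trans[OF arg_le z2]
    by (intro sums_unique[symmetric] csqrt_one_minus_sums)
  have "uniform_limit {0..pi/2} (\<lambda>n \<theta>. \<Sum>k<n. g k \<theta>) (\<lambda>\<theta>. \<Sum>k. g k \<theta>) sequentially"
  proof (rule Weierstrass_m_test)
    show "summable (\<lambda>k. norm (z\<^sup>2) ^ k)"
      using z2 by (simp add: summable_geometric)
    show "norm (g k \<theta>) \<le> norm (z\<^sup>2) ^ k" for k \<theta>
    proof -
      have "\<bar>pochhammer (-1/2) k / fact k\<bar> \<le> (1::real)"
        using abs_pochhammer_le_fact[of "-1/2" k] by simp
      moreover have "norm (z\<^sup>2 * (complex_of_real (sin \<theta>))\<^sup>2) ^ k \<le> norm (z\<^sup>2) ^ k"
        by (intro power_mono arg_le norm_ge_zero)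
      ultimately show ?thesis
        unfolding g_def norm_mult[of "of_real _"] norm_power[of _ k] norm_of_real
        using mult_mono[of "\<bar>pochhammer (-1/2) k / fact k\<bar>" "1::real"] by fastforce
    qed
  qed
  moreover have "continuous_on {0..pi/2} (\<lambda>\<theta>. \<Sum>k<n. g k \<theta>)" for n
    unfolding g_def by (intro continuous_intros)
  ultimately obtain I J where I: "\<And>n. ((\<lambda>\<theta>. \<Sum>k<n. g k \<theta>) has_integral I n) {0..pi/2}"
    and J: "((\<lambda>\<theta>. \<Sum>k. g k \<theta>) has_integral J) {0..pi/2}" and lim: "I \<longlonglongrightarrow> J"
    by (rule uniform_limit_integral) (simp, blast)
  have g_int: "(g k has_integral of_real (pi / 2) * (of_real (E_coeff k) * (z\<^sup>2) ^ k)) {0..pi/2}" for k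
  proof -
    have "((\<lambda>\<theta>. of_real (pochhammer (-1/2) k / fact k) * (z\<^sup>2) ^ k * complex_of_real (sin \<theta> ^ (2 * k)))
        has_integral of_real (pochhammer (-1/2) k / fact k) * (z\<^sup>2) ^ k *
          of_real (pi / 2 * (pochhammer (1/2) k / fact k))) {0..pi/2}"
      by (intro has_integral_mult_right has_integral_of_real wallis_integral)
    thus ?thesis
      by (simp add: g_def[abs_def] E_coeff_def power2_eq_square[of "fact k"] power_mult_distrib
          mult_ac flip: power_mult)
  qed
  have "I n = (\<Sum>k<n. of_real (pi / 2) * (of_real (E_coeff k) * (z\<^sup>2) ^ k))" for n
    by (rule has_integral_unique[OF I]) (intro has_integral_sum g_int finite_lessThan)
  hence "(\<lambda>k. of_real (pi / 2) * (of_real (E_coeff k) * (z\<^sup>2) ^ k)) sums J"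
    using lim unfolding sums_def by presburger
  moreover have "(\<lambda>k. of_real (pi / 2) * (of_real (E_coeff k) * (z\<^sup>2) ^ k)) sums
      (of_real (pi / 2) * hypergeo_2F1 (- 1 / 2) (1 / 2) 1 (z\<^sup>2))"
    unfolding hypergeo_eq_E_series
    by (intro sums_mult summable_sums summable_norm_cancel[OF summable_norm_E_series[OF z2]])
  ultimately have "J = of_real (pi / 2) * hypergeo_2F1 (- 1 / 2) (1 / 2) 1 (z\<^sup>2)"
    by (rule sums_unique2)
  moreover have "elliptic_E z = J"
    using J unfolding elliptic_E_def g_suminf by (rule integral_unique)
  ultimately show ?thesis
    by simp
qed

theorem corollary2p3:
  fixes z :: complex and u :: "nat \<Rightarrow> real"
  assumes "norm z < 1"
    and "u 0 = 1" and "u 1 = - 1 / 2"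
    and "\<And>n::nat. n \<ge> 1 \<Longrightarrow>
           u (n + 1) = (4 * real n ^ 3 - 2 * real n - 1) / (2 * (real n + 1) ^ 3) * u n
                       - (real n - 2) * (real n - 1) * real n / (real n + 1) ^ 3 * u (n - 1)"
  shows "(elliptic_E z)^2 = of_real (pi^2 / 4) * (hypergeo_2F1 (- 1 / 2) (1 / 2) 1 (z^2))^2
       \<and> summable (\<lambda>n. of_real (u n) * z ^ (2 * n))
       \<and> of_real (pi^2 / 4) * (hypergeo_2F1 (- 1 / 2) (1 / 2) 1 (z^2))^2
           = of_real (pi^2 / 4) * (\<Sum>n. of_real (u n) * z ^ (2 * n))"
proof -
  have "norm (z\<^sup>2) < 1"
    using assms(1) by (simp add: norm_power power_less_one_iff abs_square_less_1)
  moreover have "u = fps_nth ((Abs_fps E_coeff)\<^sup>2)"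
    using E_fps_sq_unique[OF assms(2-4)] by blast
  ultimately have "(\<lambda>n. of_real (u n) * z ^ (2 * n)) sums (hypergeo_2F1 (- 1 / 2) (1 / 2) 1 (z\<^sup>2))\<^sup>2"
    using hypergeo_square_sums[of "z\<^sup>2"] by (simp only: power_mult)
  moreover have "(elliptic_E z)\<^sup>2 = of_real (pi^2 / 4) * (hypergeo_2F1 (- 1 / 2) (1 / 2) 1 (z^2))\<^sup>2"
    by (simp add: elliptic_E_eq_hypergeo[OF assms(1)] power_mult_distrib power_divide)
  ultimately show ?thesis
    by (simp add: sums_iff)
qed

end
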